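(* Fix a positive real $M$. If $\mu\in\mathrm{AC}(\Gamma_M)$ is such that $\hat\mu$ vanishes on one of the axes, $\mathbb{R}\times\{0\}$ or $\{0\}\times\mathbb{R}$, then $\mu=0$ identically. In terms of Zariski closures, $$\mathrm{zclos}_{\Gamma_M}(\mathbb{R}\times\{0\})=\mathrm{zclos}_{\Gamma_M}(\{0\}\times\mathbb{R})=\mathbb{R}^2.$$
   Context: For a finite complex-valued Borel measure $\mu$ on $\mathbb{R}^2$, its Fourier transform is $\hat\mu(\xi)=\int_{\mathbb{R}^2}\mathrm{e}^{\mathrm{i}\pi\langle x,\xi\rangle}\,\mathrm{d}\mu(x)$, where $\langle x,\xi\rangle=x_1\xi_1+x_2\xi_2$. $\Gamma_M=\{x\in\mathbb{R}^2:\ x_1x_2=M^2/(4\pi^2)\}$, and $\mathrm{AC}(\Gamma_M)$ is the space of finite complex-valued Borel measures on $\mathbb{R}^2$ supported on $\Gamma_M$ that are absolutely continuous with respect to arc length measure on $\Gamma_M$. For $\Lambda\subset\mathbb{R}^2$, the Zariski closure $\mathrm{zclos}_{\Gamma_M}(\Lambda)$ is the set of all $\xi\in\mathbb{R}^2$ such that $\hat\mu(\xi)=0$ for every $\mu\in\mathrm{AC}(\Gamma_M)$ with $\hat\mu=0$ on $\Lambda$. *)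

theory Defs
  imports "HOL-Analysis.Analysis"
begin

definition complex_measure :: "'a measure \<Rightarrow> ('a set \<Rightarrow> complex) \<Rightarrow> bool" where
  "complex_measure N \<mu> \<longleftrightarrow> \<mu> {} = 0 \<and>
     (\<forall>A :: nat \<Rightarrow> 'a set. range A \<subseteq> sets N \<longrightarrow> disjoint_family A \<longrightarrow>
        (\<lambda>n. \<mu> (A n)) sums \<mu> (\<Union>n. A n))"

text \<open>
  The positive part of the Jordan decomposition of a finite signed measure \<open>\<nu>\<close>;
  the negative part is the upper variation of \<open>- \<nu>\<close>. Since \<open>ennreal\<close> sends negative
  numbers to \<open>0 = \<nu> {}\<close>, the truncation does not affect the supremum.
\<close>
definition upper_variation :: "'a measure \<Rightarrow> ('a set \<Rightarrow> real) \<Rightarrow> 'a measure" where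
  "upper_variation N \<nu> =
     measure_of (space N) (sets N) (\<lambda>A. SUP B \<in> {B \<in> sets N. B \<subseteq> A}. ennreal (\<nu> B))"

definition signed_integral :: "'a measure \<Rightarrow> ('a set \<Rightarrow> real) \<Rightarrow> ('a \<Rightarrow> complex) \<Rightarrow> complex" where
  "signed_integral N \<nu> f =
     (LINT x|upper_variation N \<nu>. f x) - (LINT x|upper_variation N (\<lambda>A. - \<nu> A). f x)"

definition complex_measure_integral ::
    "'a measure \<Rightarrow> ('a set \<Rightarrow> complex) \<Rightarrow> ('a \<Rightarrow> complex) \<Rightarrow> complex" where
  "complex_measure_integral N \<mu> f =
     signed_integral N (\<lambda>A. Re (\<mu> A)) f + \<i> * signed_integral N (\<lambda>A. Im (\<mu> A)) f"

definition fourier_transform :: "((real \<times> real) set \<Rightarrow> complex) \<Rightarrow> real \<times> real \<Rightarrow> complex" where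
  "fourier_transform \<mu> \<xi> =
     complex_measure_integral borel \<mu> (\<lambda>x. exp (\<i> * of_real (pi * (x \<bullet> \<xi>))))"

definition hyperbola :: "real \<Rightarrow> (real \<times> real) set" where
  "hyperbola M = {x. fst x * snd x = M\<^sup>2 / (4 * pi\<^sup>2)}"

definition hyperbola_param :: "real \<Rightarrow> real \<Rightarrow> real \<times> real" where
  "hyperbola_param M t = (t, M\<^sup>2 / (4 * pi\<^sup>2 * t))"

text \<open>
  Arc length on both branches (\<open>t > 0\<close> and \<open>t < 0\<close>), as a measure on the plane: the
  push-forward of \<open>norm (\<gamma>' t) dt\<close> under the parametrization \<open>\<gamma>\<close> of the hyperbola.
\<close>
definition hyperbola_arc_length :: "real \<Rightarrow> (real \<times> real) measure" where
  "hyperbola_arc_length M =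
     distr
       (density (restrict_space lborel (- {0}))
          (\<lambda>t. ennreal (norm (vector_derivative (hyperbola_param M) (at t)))))
       borel (hyperbola_param M)"

definition AC_hyperbola :: "real \<Rightarrow> ((real \<times> real) set \<Rightarrow> complex) set" where
  "AC_hyperbola M = {\<mu>. complex_measure borel \<mu> \<and>
     (\<forall>A \<in> sets borel. A \<inter> hyperbola M = {} \<longrightarrow> \<mu> A = 0) \<and>
     (\<forall>A \<in> null_sets (hyperbola_arc_length M). \<mu> A = 0)}"

definition zclos :: "real \<Rightarrow> (real \<times> real) set \<Rightarrow> (real \<times> real) set" where
  "zclos M \<Lambda> = {\<xi>. \<forall>\<mu> \<in> AC_hyperbola M.
     (\<forall>\<eta> \<in> \<Lambda>. fourier_transform \<mu> \<eta> = 0) \<longrightarrow> fourier_transform \<mu> \<xi> = 0}"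

lemma hyperbola_param_image:
  assumes "M > 0"
  shows "hyperbola_param M ` (- {0}) = hyperbola M"
proof
  show "hyperbola_param M ` (- {0}) \<subseteq> hyperbola M"
    by (auto simp: hyperbola_param_def hyperbola_def)
  show "hyperbola M \<subseteq> hyperbola_param M ` (- {0})"
  proof
    fix x assume x: "x \<in> hyperbola M"
    then have "fst x \<noteq> 0"
      using assms by (auto simp: hyperbola_def)
    moreover have "x = hyperbola_param M (fst x)"
      using x \<open>fst x \<noteq> 0\<close>
      by (auto simp: hyperbola_def hyperbola_param_def prod_eq_iff field_simps)
    ultimately show "x \<in> hyperbola_param M ` (- {0})"
      by blast
  qed
qed

lemma vector_derivative_hyperbola_param:
  assumes "t \<noteq> 0"
  shows "vector_derivative (hyperbola_param M) (at t) = (1, - (M\<^sup>2 / (4 * pi\<^sup>2 * t\<^sup>2)))"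
proof (rule vector_derivative_at)
  have "((\<lambda>t. M\<^sup>2 / (4 * pi\<^sup>2 * t)) has_vector_derivative - (M\<^sup>2 / (4 * pi\<^sup>2 * t\<^sup>2))) (at t)"
    unfolding has_real_derivative_iff_has_vector_derivative[symmetric]
    using assms by (auto intro!: derivative_eq_intros simp: field_simps power2_eq_square)
  then show "(hyperbola_param M has_vector_derivative (1, - (M\<^sup>2 / (4 * pi\<^sup>2 * t\<^sup>2)))) (at t)"
    unfolding hyperbola_param_def[abs_def]
    by (intro has_vector_derivative_Pair has_vector_derivative_id)
qed

end

theory Submission
  imports Defs "HOL-Probability.Levy"
begin

text \<open>
  The coordinate projections are injective on the hyperbola, so a measure carried by it is
  determined by its push-forward under either of them, and the Fourier transform on an axis
  is the one-dimensional Fourier transform of such a push-forward. Replacing \<open>\<xi>\<close> by \<open>- \<xi>\<close>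
  conjugates the transform of a real measure, so the transforms of the real and the imaginary part
  vanish separately; by Levy's uniqueness theorem, the positive and the negative part of each
  have the same push-forward.
\<close>

section \<open>Jordan decomposition of finite signed measures\<close>

text \<open>Real-valued, so finite by definition; the map is total and constrained only on
  \<open>sets N\<close>, which is the form taken by the real and imaginary parts of a
  \<open>complex_measure\<close>.\<close>

locale signed_measure =
  fixes N :: "'a measure" and \<nu> :: "'a set \<Rightarrow> real"
  assumes empty: "\<nu> {} = 0"
    and sums_UN: "range A \<subseteq> sets N \<Longrightarrow> disjoint_family A \<Longrightarrow>
      (\<lambda>n. \<nu> (A n)) sums \<nu> (\<Union>n::nat. A n)"
begin

text \<open>The negative part is the upper variation of \<open>- \<nu>\<close>, so this transfers
  every result about the positive part to it.\<close>

lemma uminus: "signed_measure N (\<lambda>A. - \<nu> A)"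
  by unfold_locales (auto simp: empty intro!: sums_minus sums_UN)

lemma additive:
  assumes "A \<in> sets N" "B \<in> sets N" "A \<inter> B = {}"
  shows "\<nu> (A \<union> B) = \<nu> A + \<nu> B"
proof -
  have "(\<lambda>n. \<nu> (binaryset A B n)) sums \<nu> (\<Union>n. binaryset A B n)"
    using assms by (intro sums_UN) (auto simp: binaryset_def disjoint_family_on_def)
  moreover have "(\<lambda>n. \<nu> (binaryset A B n)) sums (\<nu> A + \<nu> B)"
    by (rule binaryset_sums) (rule empty)
  ultimately show ?thesis
    by (simp add: UN_binaryset_eq sums_unique2)
qed

lemma Diff:
  assumes "A \<in> sets N" "B \<in> sets N" "B \<subseteq> A"
  shows "\<nu> (A - B) = \<nu> A - \<nu> B"
  using additive[of "A - B" B] assms by (simp add: Un_absorb2 Int_commute)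

section \<open>The upper variation as a measure\<close>

definition upper :: "'a set \<Rightarrow> ennreal" where
  "upper A = (SUP B \<in> {B \<in> sets N. B \<subseteq> A}. ennreal (\<nu> B))"

lemma le_upper: "B \<in> sets N \<Longrightarrow> B \<subseteq> A \<Longrightarrow> ennreal (\<nu> B) \<le> upper A"
  unfolding upper_def by (rule SUP_upper) auto

lemma upper_empty: "upper {} = 0"
  by (auto simp: upper_def empty intro!: antisym SUP_least)

lemma upper_mono: "A \<subseteq> B \<Longrightarrow> upper A \<le> upper B"
  unfolding upper_def by (rule SUP_subset_mono) auto

text \<open>A measurable subset of \<open>A\<close> and one of \<open>B\<close> are disjoint, so
  their union is a candidate in the supremum for \<open>A \<union> B\<close>.\<close>

lemma upper_superadditive:
  assumes "A \<inter> B = {}"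
  shows "upper A + upper B \<le> upper (A \<union> B)"
proof -
  have le: "ennreal (\<nu> C) + ennreal (\<nu> D) \<le> upper (A \<union> B)"
    if C: "C \<in> sets N" "C \<subseteq> A" and D: "D \<in> sets N" "D \<subseteq> B" for C D
  \<comment> \<open>Truncation makes \<open>ennreal\<close> additive only on nonnegative values; if
    one value is negative, it contributes \<open>0\<close> and the other set alone is a sufficient
    candidate.\<close>
  proof (cases "\<nu> C \<ge> 0 \<and> \<nu> D \<ge> 0")
    case True
    then have "ennreal (\<nu> C) + ennreal (\<nu> D) = ennreal (\<nu> (C \<union> D))"
      using assms C D by (subst additive) auto
    also have "\<dots> \<le> upper (A \<union> B)"
      using C D by (intro le_upper) auto
    finally show ?thesis .
  next
    case False
    then have "ennreal (\<nu> C) = 0 \<or> ennreal (\<nu> D) = 0"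
      by (auto simp: ennreal_neg)
    moreover have "ennreal (\<nu> C) \<le> upper (A \<union> B)" "ennreal (\<nu> D) \<le> upper (A \<union> B)"
      using C D by (auto intro!: le_upper)
    ultimately show ?thesis
      by auto
  qed
  have ne: "{C \<in> sets N. C \<subseteq> X} \<noteq> {}" for X
    by auto
  have "upper A + upper B = (SUP C \<in> {C \<in> sets N. C \<subseteq> A}. ennreal (\<nu> C) + upper B)"
    unfolding upper_def[of A] by (rule ennreal_SUP_add_left[OF ne, symmetric])
  also have "\<dots> \<le> upper (A \<union> B)"
  proof (rule SUP_least)
    fix C assume C: "C \<in> {C \<in> sets N. C \<subseteq> A}"
    have "ennreal (\<nu> C) + upper B =
        (SUP D \<in> {D \<in> sets N. D \<subseteq> B}. ennreal (\<nu> C) + ennreal (\<nu> D))"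
      unfolding upper_def[of B] by (rule ennreal_SUP_add_right[OF ne])
    also have "\<dots> \<le> upper (A \<union> B)"
      using C le by (intro SUP_least) auto
    finally show "ennreal (\<nu> C) + upper B \<le> upper (A \<union> B)" .
  qed
  finally show ?thesis .
qed

text \<open>Superadditivity and monotonicity bound the partial sums by the value of the union.
  Conversely, a candidate \<open>B\<close> for the union is cut into the pieces
  \<open>B \<inter> A i\<close>, and countable additivity of \<open>\<nu>\<close> bounds
  \<open>\<nu> B\<close>.\<close>

lemma upper_countably_additive: "countably_additive (sets N) upper"
proof (rule countably_additiveI)
  fix A :: "nat \<Rightarrow> 'a set"
  assume A: "range A \<subseteq> sets N" "disjoint_family A" "(\<Union>i. A i) \<in> sets N"
  have partial: "(\<Sum>i<k. upper (A i)) \<le> upper (\<Union>i<k. A i)" for k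
  proof (induction k)
    case (Suc k)
    have disj: "(\<Union>i<k. A i) \<inter> A k = {}"
      using disjoint_family_onD[OF A(2), of _ k] by fastforce
    have "(\<Sum>i<Suc k. upper (A i)) \<le> upper (\<Union>i<k. A i) + upper (A k)"
      using Suc by (simp add: add_right_mono)
    also have "\<dots> \<le> upper ((\<Union>i<k. A i) \<union> A k)"
      by (rule upper_superadditive) (rule disj)
    also have "(\<Union>i<k. A i) \<union> A k = (\<Union>i<Suc k. A i)"
      by (auto simp: lessThan_Suc)
    finally show ?case .
  qed (simp add: upper_empty)
  show "(\<Sum>i. upper (A i)) = upper (\<Union>i. A i)"
  proof (rule antisym)
    have "(\<Sum>i<k. upper (A i)) \<le> upper (\<Union>i. A i)" for k
      using partial[of k] upper_mono[of "\<Union>i<k. A i" "\<Union>i. A i"] by (meson UN_mono order_trans subset_UNIV subset_refl)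
    then show "(\<Sum>i. upper (A i)) \<le> upper (\<Union>i. A i)"
      by (intro suminf_le_const) auto
    show "upper (\<Union>i. A i) \<le> (\<Sum>i. upper (A i))"
      unfolding upper_def[of "\<Union>i. A i"]
    proof (rule SUP_least)
      fix B assume "B \<in> {B \<in> sets N. B \<subseteq> (\<Union>i. A i)}"
      then have B: "B \<in> sets N" "B = (\<Union>i. B \<inter> A i)" "range (\<lambda>i. B \<inter> A i) \<subseteq> sets N"
        using A(1) by auto
      have "disjoint_family (\<lambda>i. B \<inter> A i)"
        using A(2) by (auto simp: disjoint_family_on_def)
      then have S: "(\<lambda>i. \<nu> (B \<inter> A i)) sums \<nu> B"
        using sums_UN[OF B(3)] B(2) by metis
      have "ennreal (\<Sum>i<k. \<nu> (B \<inter> A i)) \<le> (\<Sum>i. upper (A i))" for k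
      proof -
        \<comment> \<open>The pieces may have mixed signs; passing to positive parts first allows
          \<open>ennreal\<close> to be moved inside the sum.\<close>
        have "ennreal (\<Sum>i<k. \<nu> (B \<inter> A i)) \<le> ennreal (\<Sum>i<k. max 0 (\<nu> (B \<inter> A i)))"
          by (intro ennreal_leI sum_mono) auto
        also have "\<dots> = (\<Sum>i<k. ennreal (max 0 (\<nu> (B \<inter> A i))))"
          by (rule sum_ennreal[symmetric]) auto
        also have "\<dots> = (\<Sum>i<k. ennreal (\<nu> (B \<inter> A i)))"
          by (intro sum.cong refl) (simp add: max_def ennreal_neg)
        also have "\<dots> \<le> (\<Sum>i<k. upper (A i))"
          using B by (intro sum_mono le_upper) auto
        also have "\<dots> \<le> (\<Sum>i. upper (A i))"
          by (intro sum_le_suminf) auto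
        finally show ?thesis .
      qed
      moreover have "(\<lambda>k. ennreal (\<Sum>i<k. \<nu> (B \<inter> A i))) \<longlonglongrightarrow> ennreal (\<nu> B)"
        using S unfolding sums_def by (rule tendsto_ennrealI)
      ultimately show "ennreal (\<nu> B) \<le> (\<Sum>i. upper (A i))"
        by (intro LIMSEQ_le_const2) auto
    qed
  qed
qed

lemma sets_upper_variation [simp, measurable_cong]: "sets (upper_variation N \<nu>) = sets N"
  by (simp add: upper_variation_def)

lemma space_upper_variation [simp]: "space (upper_variation N \<nu>) = space N"
  by (simp add: upper_variation_def)

lemma emeasure_upper_variation: "A \<in> sets N \<Longrightarrow> emeasure (upper_variation N \<nu>) A = upper A"
  unfolding upper_variation_def upper_def[symmetric]
  using upper_countably_additive
  by (intro emeasure_measure_of_sigma)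
     (auto simp: positive_def upper_empty sets.sigma_algebra_axioms)

text \<open>
  If the variation of \<open>A\<close> is infinite, one can split off a set of large measure such that one of the
  two pieces still has infinite variation; both pieces have measure at least \<open>1\<close> in modulus.
\<close>
lemma upper_infinite_split:
  assumes A: "A \<in> sets N" and inf: "upper A = \<infinity>"
  obtains B where "B \<in> sets N" "B \<subseteq> A" "upper B = \<infinity>" "1 \<le> \<bar>\<nu> (A - B)\<bar>"
proof -
  \<comment> \<open>With this margin, \<open>\<nu> B > 1\<close> and \<open>\<bar>\<nu> (A -
    B)\<bar> \<ge> \<nu> B - \<bar>\<nu> A\<bar> > 1\<close>, so either piece may be the one
    removed.\<close>
  have "ennreal (\<bar>\<nu> A\<bar> + 1) < upper A"
    by (simp add: inf)
  then obtain B where B: "B \<in> sets N" "B \<subseteq> A" "ennreal (\<bar>\<nu> A\<bar> + 1) < ennreal (\<nu> B)"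
    unfolding upper_def less_SUP_iff by auto
  then have large: "\<bar>\<nu> A\<bar> + 1 < \<nu> B"
    using B(3) by (subst (asm) ennreal_less_iff) auto
  have "upper B + upper (A - B) = upper A"
    using plus_emeasure[of B "upper_variation N \<nu>" "A - B"] A B(1,2)
    by (simp add: emeasure_upper_variation Un_absorb1)
  then consider "upper B = \<infinity>" | "upper (A - B) = \<infinity>"
    using inf by auto
  then show ?thesis
  proof cases
    case 1
    then show ?thesis
      using that[of B] A B(1,2) large Diff[of A B] by auto
  next
    case 2
    have "A - (A - B) = B"
      using B(2) by auto
    then show ?thesis
      using that[of "A - B"] 2 A B(1,2) large by auto
  qed
qed

text \<open>Repeated splitting of a set of infinite variation gives a decreasing sequence whose
  successive differences are disjoint and have measure at least \<open>1\<close> in modulus. Their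
  measures would form a convergent series whose terms do not tend to \<open>0\<close>.\<close>

lemma upper_finite:
  assumes "A \<in> sets N"
  shows "upper A \<noteq> \<infinity>"
proof
  assume inf: "upper A = \<infinity>"
  let ?P = "\<lambda>n::nat. \<lambda>B. B \<in> sets N \<and> upper B = \<infinity>"
  let ?Q = "\<lambda>n::nat. \<lambda>B C. C \<subseteq> B \<and> 1 \<le> \<bar>\<nu> (B - C)\<bar>"
  have "\<exists>f. \<forall>n. ?P n (f n) \<and> ?Q n (f n) (f (Suc n))"
  proof (rule dependent_nat_choice)
    show "\<exists>B. ?P 0 B"
      using assms inf by auto
    show "\<exists>C. ?P (Suc n) C \<and> ?Q n B C" if "?P n B" for B n
      using that upper_infinite_split[of B] by metis
  qed
  then obtain f where f: "\<And>n. f n \<in> sets N" "\<And>n. f (Suc n) \<subseteq> f n"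
      "\<And>n. 1 \<le> \<bar>\<nu> (f n - f (Suc n))\<bar>"
    by auto
  have mono: "f n \<subseteq> f m" if "m \<le> n" for m n
    using lift_Suc_antimono_le[of f] f(2) that by auto
  have disj: "(f m - f (Suc m)) \<inter> (f n - f (Suc n)) = {}" if "m < n" for m n
    using mono[of "Suc m" n] that by auto
  have "disjoint_family (\<lambda>n. f n - f (Suc n))"
    unfolding disjoint_family_on_def using disj by (metis Int_commute linorder_neqE_nat)
  then have "(\<lambda>n. \<nu> (f n - f (Suc n))) sums \<nu> (\<Union>n. f n - f (Suc n))"
    using f(1) by (intro sums_UN) auto
  then have "(\<lambda>n. \<nu> (f n - f (Suc n))) \<longlonglongrightarrow> 0"
    by (intro summable_LIMSEQ_zero) (auto simp: sums_iff)
  then have "(\<lambda>n. \<bar>\<nu> (f n - f (Suc n))\<bar>) \<longlonglongrightarrow> 0"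
    by (rule tendsto_rabs_zero)
  then have "1 \<le> (0::real)"
    by (rule LIMSEQ_le_const) (use f(3) in auto)
  then show False
    by simp
qed

lemma finite_measure_upper_variation: "finite_measure (upper_variation N \<nu>)"
  by (rule finite_measureI) (use upper_finite[of "space N"] in \<open>simp add: emeasure_upper_variation\<close>)

text \<open>For measurable \<open>B \<subseteq> A\<close>,
  \<open>\<nu> B = \<nu> A - \<nu> (A - B)\<close>, and \<open>- \<nu> (A - B)\<close> is at most
  the negative variation of \<open>A\<close>; then take the supremum over \<open>B\<close>.\<close>

lemma le_upper_variation_add:
  assumes A: "A \<in> sets N"
  shows "measure (upper_variation N \<nu>) A \<le> \<nu> A + measure (upper_variation N (\<lambda>A. - \<nu> A)) A"
proof -
  interpret neg: signed_measure N "\<lambda>A. - \<nu> A"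
    by (rule uminus)
  interpret P: finite_measure "upper_variation N \<nu>"
    by (rule finite_measure_upper_variation)
  interpret Q: finite_measure "upper_variation N (\<lambda>A. - \<nu> A)"
    by (rule neg.finite_measure_upper_variation)
  let ?q = "measure (upper_variation N (\<lambda>A. - \<nu> A)) A"
  have q: "- \<nu> B \<le> ?q" if B: "B \<in> sets N" "B \<subseteq> A" for B
    using neg.le_upper[OF B] A
    by (simp add: neg.emeasure_upper_variation[symmetric] Q.emeasure_eq_measure)
  have "upper A \<le> ennreal (\<nu> A + ?q)"
    unfolding upper_def
  proof (rule SUP_least)
    fix B assume "B \<in> {B \<in> sets N. B \<subseteq> A}"
    then have "\<nu> B \<le> \<nu> A + ?q"
      using q[of "A - B"] A Diff[of A B] by auto
    then show "ennreal (\<nu> B) \<le> ennreal (\<nu> A + ?q)"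
      by (rule ennreal_leI)
  qed
  \<comment> \<open>The case \<open>B = A\<close> of \<open>q\<close> makes
    \<open>\<nu> A + ?q\<close> nonnegative, so the bound in \<open>ennreal\<close> is not truncated
    and descends to the reals.\<close>
  then show ?thesis
    using A q[of A] by (simp add: emeasure_upper_variation[symmetric] P.emeasure_eq_measure)
qed

text \<open>The previous inequality for \<open>\<nu>\<close> and for \<open>- \<nu>\<close> gives
  the two halves of the identity.\<close>

theorem Jordan_decomposition:
  assumes "A \<in> sets N"
  shows "\<nu> A = measure (upper_variation N \<nu>) A - measure (upper_variation N (\<lambda>A. - \<nu> A)) A"
  using le_upper_variation_add[OF assms] signed_measure.le_upper_variation_add[OF uminus assms]
  by simp

end

section \<open>From signed to complex measures\<close>

lemma complex_measure_signed_measure: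
  assumes "complex_measure N \<mu>"
  shows "signed_measure N (\<lambda>A. Re (\<mu> A))" "signed_measure N (\<lambda>A. Im (\<mu> A))"
  using assms unfolding complex_measure_def signed_measure_def
  by (auto intro: sums_Re sums_Im)

text \<open>The upper variation depends only on values on \<open>sets N\<close>. There
  \<open>\<nu>\<close> and \<open>- \<nu>\<close> agree, so the two variations coincide and their
  integrals cancel.\<close>

lemma complex_measure_integral_eq_0:
  assumes \<mu>: "complex_measure N \<mu>" and zero: "\<And>A. A \<in> sets N \<Longrightarrow> \<mu> A = 0"
  shows "complex_measure_integral N \<mu> f = 0"
proof -
  have "signed_integral N \<nu> f = 0"
    if "signed_measure N \<nu>" and 0: "\<And>A. A \<in> sets N \<Longrightarrow> \<nu> A = 0" for \<nu>
  proof -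
    interpret signed_measure N \<nu> by fact
    interpret neg: signed_measure N "\<lambda>A. - \<nu> A" by (rule uminus)
    have "upper_variation N \<nu> = upper_variation N (\<lambda>A. - \<nu> A)"
      by (rule measure_eqI)
         (auto simp: emeasure_upper_variation neg.emeasure_upper_variation
           upper_def neg.upper_def 0 intro!: SUP_cong)
    then show ?thesis
      by (simp add: signed_integral_def)
  qed
  then show ?thesis
    using complex_measure_signed_measure[OF \<mu>] zero
    by (simp add: complex_measure_integral_def)
qed

section \<open>Uniqueness of characteristic functions\<close>

text \<open>Reduction to \<open>Levy_uniqueness\<close> for probability distributions: the total
  masses agree, and both measures are divided by the common mass.\<close>

lemma finite_Levy_uniqueness:
  assumes "finite_measure P" "finite_measure Q"
    and [measurable_cong]: "sets P = sets borel" "sets Q = sets borel"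
    and eq: "char P = char Q"
  shows "P = Q"
proof -
  interpret P: finite_measure P by fact
  interpret Q: finite_measure Q by fact
  have space: "space P = UNIV" "space Q = UNIV"
    using assms(3,4)[THEN sets_eq_imp_space_eq] by auto
  define m where "m = measure P UNIV"
  \<comment> \<open>The characteristic function at \<open>0\<close> is the total mass.\<close>
  have mass: "measure Q UNIV = m"
    using fun_cong[OF eq, of 0] by (simp add: char_def m_def space)
  show ?thesis
  \<comment> \<open>Mass \<open>0\<close> cannot be normalised, but then both measures are the zero
    measure.\<close>
  proof (cases "m = 0")
    case True
    have "emeasure P A = 0" "emeasure Q A = 0" for A
      using P.bounded_measure[of A] Q.bounded_measure[of A] True mass
      by (auto simp: P.emeasure_eq_measure Q.emeasure_eq_measure m_def space measure_le_0_iff)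
    then show ?thesis
      by (intro measure_eqI) (auto simp: assms)
  next
    case False
    then have m: "m > 0"
      by (simp add: m_def zero_less_measure_iff order_less_le)
    define D where "D R = density R (\<lambda>_. ennreal (1 / m))" for R :: "real measure"
    have D: "real_distribution (D R)" "char (D R) = (\<lambda>t. char R t / m)"
      if "finite_measure R" and [measurable_cong]: "sets R = sets borel"
        and "measure R UNIV = m" for R
    proof -
      interpret R: finite_measure R by fact
      have R: "space R = UNIV"
        using that(2)[THEN sets_eq_imp_space_eq] by simp
      show "real_distribution (D R)"
      proof (intro real_distribution.intro real_distribution_axioms.intro prob_spaceI)
        show "emeasure (D R) (space (D R)) = 1"
          using m that(3)
          by (simp add: D_def R emeasure_density R.emeasure_eq_measure
              ennreal_mult[symmetric] flip: ennreal_1)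
        show "sets (D R) = sets borel"
          by (simp add: D_def that(2))
      qed
      show "char (D R) = (\<lambda>t. char R t / m)"
      proof
        fix t
        have "char (D R) t = (CLINT x|R. (1 / m) *\<^sub>R iexp (t * x))"
          unfolding char_def D_def
        proof (rule integral_density)
          show "(\<lambda>x. iexp (t * x)) \<in> borel_measurable R"
            by measurable
        qed (use m in simp_all)
        also have "\<dots> = (1 / m) *\<^sub>R char R t"
          by (simp only: integral_scaleR_right char_def)
        finally show "char (D R) t = char R t / m"
          by (simp add: scaleR_conv_of_real)
      qed
    qed
    have DP: "real_distribution (D P)" "char (D P) = (\<lambda>t. char P t / m)"
      by (rule D; simp add: assms m_def)+
    have DQ: "real_distribution (D Q)" "char (D Q) = (\<lambda>t. char Q t / m)"
      by (rule D; simp add: assms mass)+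
    have "D P = D Q"
      using DP DQ eq by (intro Levy_uniqueness) auto
    then have "ennreal (1 / m) * emeasure P A = ennreal (1 / m) * emeasure Q A"
      if "A \<in> sets borel" for A
      using that emeasure_density_const[of A P "ennreal (1 / m)"]
        emeasure_density_const[of A Q "ennreal (1 / m)"]
      by (simp add: D_def assms)
    then have "emeasure P A = emeasure Q A" if "A \<in> sets borel" for A
      using that m by (simp add: ennreal_mult_cancel_left)
    then show ?thesis
      by (intro measure_eqI) (auto simp: assms)
  qed
qed

section \<open>Signed and complex measures with vanishing transforms\<close>

lemma char_uminus: "char R (- t) = cnj (char R t)"
  unfolding char_def Bochner_Integration.integral_cnj[symmetric]
  by (simp add: exp_cnj del: Bochner_Integration.integral_cnj)

lemma (in signed_measure) signed_integral_iexp: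
  assumes [measurable]: "f \<in> borel_measurable N"
  shows "signed_integral N \<nu> (\<lambda>x. exp (\<i> * of_real (t * f x))) =
    char (distr (upper_variation N \<nu>) borel f) t -
    char (distr (upper_variation N (\<lambda>A. - \<nu> A)) borel f) t"
proof -
  interpret neg: signed_measure N "\<lambda>A. - \<nu> A"
    by (rule uminus)
  show ?thesis
    unfolding signed_integral_def char_def
    by (subst (1 2) integral_distr) simp_all
qed

text \<open>The push-forwards of the positive and the negative part have equal characteristic
  functions, hence are equal; by the Jordan decomposition, \<open>\<nu>\<close> of a preimage is the
  difference of their values.\<close>

lemma (in signed_measure) vimage_eq_0:
  assumes f [measurable]: "f \<in> borel_measurable N"
    and zero: "\<And>t. signed_integral N \<nu> (\<lambda>x. exp (\<i> * of_real (t * f x))) = 0"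
    and B: "B \<in> sets borel"
  shows "\<nu> (f -` B \<inter> space N) = 0"
proof -
  interpret neg: signed_measure N "\<lambda>A. - \<nu> A"
    by (rule uminus)
  let ?P = "upper_variation N \<nu>" and ?Q = "upper_variation N (\<lambda>A. - \<nu> A)"
  have "char (distr ?P borel f) t = char (distr ?Q borel f) t" for t
    using zero[of t] unfolding signed_integral_iexp[OF f] by simp
  then have "distr ?P borel f = distr ?Q borel f"
    using finite_measure_upper_variation neg.finite_measure_upper_variation
    by (intro finite_Levy_uniqueness finite_measure.finite_measure_distr)
       (auto simp: fun_eq_iff)
  then have "measure (distr ?P borel f) B = measure (distr ?Q borel f) B"
    by simp
  then show ?thesis
    using B by (simp add: measure_distr Jordan_decomposition)
qed

lemma complex_measure_vimage_eq_0:
  assumes \<mu>: "complex_measure N \<mu>" and f: "f \<in> borel_measurable N"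
    and zero: "\<And>t. complex_measure_integral N \<mu> (\<lambda>x. exp (\<i> * of_real (t * f x))) = 0"
    and B: "B \<in> sets borel"
  shows "\<mu> (f -` B \<inter> space N) = 0"
proof -
  interpret R: signed_measure N "\<lambda>A. Re (\<mu> A)"
    by (rule complex_measure_signed_measure[OF \<mu>])
  interpret I: signed_measure N "\<lambda>A. Im (\<mu> A)"
    by (rule complex_measure_signed_measure[OF \<mu>])
  define r where "r t = signed_integral N (\<lambda>A. Re (\<mu> A)) (\<lambda>x. exp (\<i> * of_real (t * f x)))" for t
  define s where "s t = signed_integral N (\<lambda>A. Im (\<mu> A)) (\<lambda>x. exp (\<i> * of_real (t * f x)))" for t
  have rs: "r t + \<i> * s t = 0" for t
    using zero[of t] by (simp add: complex_measure_integral_def r_def s_def)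
  \<comment> \<open>The values \<open>r t\<close> and \<open>s t\<close> are themselves complex, so
    \<open>rs\<close> alone does not separate them. Conjugating \<open>rs\<close> at
    \<open>- t\<close> supplies the second equation, with the opposite sign.\<close>
  have cnj: "r (- t) = cnj (r t)" "s (- t) = cnj (s t)" for t
    unfolding r_def s_def R.signed_integral_iexp[OF f] I.signed_integral_iexp[OF f] char_uminus
    by simp_all
  have rs': "r t - \<i> * s t = 0" for t
    using arg_cong[OF rs[of "- t"], of cnj] by (simp add: cnj)
  have "r t = 0 \<and> s t = 0" for t
    using rs[of t] rs'[of t] by (simp add: complex_eq_iff)
  then have "Re (\<mu> (f -` B \<inter> space N)) = 0" "Im (\<mu> (f -` B \<inter> space N)) = 0"
    using R.vimage_eq_0[OF f _ B] I.vimage_eq_0[OF f _ B] by (simp_all add: r_def s_def)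
  then show ?thesis
    by (simp add: complex_eq_iff)
qed

section \<open>Measures carried by a graph\<close>

lemma complex_measure_additive:
  assumes \<mu>: "complex_measure N \<mu>" and "A \<in> sets N" "B \<in> sets N" "A \<inter> B = {}"
  shows "\<mu> (A \<union> B) = \<mu> A + \<mu> B"
  using signed_measure.additive[OF complex_measure_signed_measure(1)[OF \<mu>] assms(2-)]
    signed_measure.additive[OF complex_measure_signed_measure(2)[OF \<mu>] assms(2-)]
  by (simp add: complex_eq_iff)

lemma complex_measure_graph_eq_0:
  fixes f :: "'a \<Rightarrow> real"
  assumes \<mu>: "complex_measure N \<mu>" and f: "f \<in> borel_measurable N"
    and zero: "\<And>t. complex_measure_integral N \<mu> (\<lambda>x. exp (\<i> * of_real (t * f x))) = 0"
    and g: "g \<in> measurable borel N" and H: "H \<in> sets N" "\<And>x. x \<in> H \<Longrightarrow> g (f x) = x"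
    and supp: "\<And>A. A \<in> sets N \<Longrightarrow> A \<inter> H = {} \<Longrightarrow> \<mu> A = 0"
    and A: "A \<in> sets N"
  shows "\<mu> A = 0"
proof -
  have meas: "g -` A \<in> sets borel"
    using measurable_sets[OF g A] by simp
  let ?C = "f -` (g -` A) \<inter> space N"
  have C: "?C \<in> sets N"
    by (rule measurable_sets[OF f meas])
  have agree: "A \<inter> H = ?C \<inter> H"
    using H sets.sets_into_space[OF A] by auto
  have restrict: "\<mu> X = \<mu> (X \<inter> H)" if X: "X \<in> sets N" for X
  proof -
    have "\<mu> ((X \<inter> H) \<union> (X - H)) = \<mu> (X \<inter> H) + \<mu> (X - H)"
      using X H(1) by (intro complex_measure_additive[OF \<mu>]) auto
    moreover have "\<mu> (X - H) = 0"
      using X H(1) by (intro supp) auto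
    ultimately show ?thesis
      by (simp add: Int_Diff_Un)
  qed
  have "\<mu> A = \<mu> ?C"
    using restrict[OF A] restrict[OF C] agree by simp
  also have "\<dots> = 0"
    by (rule complex_measure_vimage_eq_0[OF \<mu> f zero meas])
  finally show ?thesis .
qed

section \<open>Application to the hyperbola\<close>

lemma AC_hyperbola_eq_0:
  assumes M: "M > 0" and \<mu>: "\<mu> \<in> AC_hyperbola M"
    and vanish: "(\<forall>\<xi> \<in> UNIV \<times> {0}. fourier_transform \<mu> \<xi> = 0) \<or>
      (\<forall>\<xi> \<in> {0} \<times> UNIV. fourier_transform \<mu> \<xi> = 0)"
    and A: "A \<in> sets borel"
  shows "\<mu> A = 0"
proof -
  define c where "c = M\<^sup>2 / (4 * pi\<^sup>2)"
  have c: "c \<noteq> 0"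
    using M by (simp add: c_def)
  have H: "hyperbola M = {x. fst x * snd x = c}"
    by (simp add: hyperbola_def c_def)
  have H_borel: "hyperbola M \<in> sets borel"
    unfolding H by (intro borel_closed closed_Collect_eq continuous_intros)
  have cm: "complex_measure borel \<mu>"
    and supp: "\<And>A. A \<in> sets borel \<Longrightarrow> A \<inter> hyperbola M = {} \<Longrightarrow> \<mu> A = 0"
    using \<mu> by (auto simp: AC_hyperbola_def)
  \<comment> \<open>Each coordinate determines the other on the hyperbola. The value
    \<open>c / 0 = 0\<close> is harmless, because \<open>c \<noteq> 0\<close> keeps both coordinates
    nonzero there.\<close>
  have graph: "(\<lambda>t. (t, c / t)) \<in> measurable borel borel" "(\<lambda>t. (c / t, t)) \<in> measurable borel borel"
    "(fst :: real \<times> real \<Rightarrow> real) \<in> borel_measurable borel"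
    "(snd :: real \<times> real \<Rightarrow> real) \<in> borel_measurable borel"
    "\<And>x. x \<in> hyperbola M \<Longrightarrow> (fst x, c / fst x) = x" "\<And>x. x \<in> hyperbola M \<Longrightarrow> (c / snd x, snd x) = x"
    using c by (auto simp: H borel_prod[symmetric])
  show ?thesis
    using vanish
  proof
    assume 0: "\<forall>\<xi> \<in> UNIV \<times> {0}. fourier_transform \<mu> \<xi> = 0"
    have "complex_measure_integral borel \<mu> (\<lambda>x. exp (\<i> * of_real (t * fst x))) = 0" for t
      \<comment> \<open>Dividing by \<open>pi\<close> cancels the factor \<open>pi\<close> in the
        exponent of the Fourier transform.\<close>
      using bspec[OF 0, of "(t / pi, 0)"]
      by (simp add: fourier_transform_def inner_prod_def mult.commute)
    from complex_measure_graph_eq_0[OF cm _ this _ H_borel, where g = "\<lambda>t. (t, c / t)"]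
    show ?thesis
      using c by (simp add: supp A graph)
  next
    assume 0: "\<forall>\<xi> \<in> {0} \<times> UNIV. fourier_transform \<mu> \<xi> = 0"
    have "complex_measure_integral borel \<mu> (\<lambda>x. exp (\<i> * of_real (t * snd x))) = 0" for t
      using bspec[OF 0, of "(0, t / pi)"]
      by (simp add: fourier_transform_def inner_prod_def mult.commute)
    from complex_measure_graph_eq_0[OF cm _ this _ H_borel, where g = "\<lambda>t. (c / t, t)"]
    show ?thesis
      using c by (simp add: supp A graph)
  qed
qed

text \<open>Vanishing of \<open>\<mu>\<close> is expressed on \<open>sets borel\<close>, the sets on
  which a complex Borel measure is constrained.\<close>

theorem proposition1p7p1:
  fixes M :: real
  assumes "M > 0"
  shows "(\<forall>\<mu> \<in> AC_hyperbola M.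
            (\<forall>\<xi> \<in> UNIV \<times> {0}. fourier_transform \<mu> \<xi> = 0) \<or>
            (\<forall>\<xi> \<in> {0} \<times> UNIV. fourier_transform \<mu> \<xi> = 0) \<longrightarrow>
            (\<forall>A \<in> sets borel. \<mu> A = 0))
         \<and> zclos M (UNIV \<times> {0}) = UNIV
         \<and> zclos M ({0} \<times> UNIV) = UNIV"
proof (intro conjI)
  have eq_0: "\<mu> A = 0"
    if "\<mu> \<in> AC_hyperbola M" "A \<in> sets borel"
      "(\<forall>\<xi> \<in> UNIV \<times> {0}. fourier_transform \<mu> \<xi> = 0) \<or>
       (\<forall>\<xi> \<in> {0} \<times> UNIV. fourier_transform \<mu> \<xi> = 0)" for \<mu> A
    using AC_hyperbola_eq_0[OF assms] that by blast
  \<comment> \<open>A measure in the test class of either closure is zero on Borel sets, so its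
    transform vanishes at every point and no point is excluded from the closure.\<close>
  have fourier_0: "fourier_transform \<mu> \<xi> = 0"
    if "\<mu> \<in> AC_hyperbola M"
      "(\<forall>\<xi> \<in> UNIV \<times> {0}. fourier_transform \<mu> \<xi> = 0) \<or>
       (\<forall>\<xi> \<in> {0} \<times> UNIV. fourier_transform \<mu> \<xi> = 0)" for \<mu> \<xi>
    unfolding fourier_transform_def
    using that eq_0[OF that(1) _ that(2)]
    by (intro complex_measure_integral_eq_0) (auto simp: AC_hyperbola_def)
  show "\<forall>\<mu> \<in> AC_hyperbola M.
      (\<forall>\<xi> \<in> UNIV \<times> {0}. fourier_transform \<mu> \<xi> = 0) \<or>
      (\<forall>\<xi> \<in> {0} \<times> UNIV. fourier_transform \<mu> \<xi> = 0) \<longrightarrow>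
      (\<forall>A \<in> sets borel. \<mu> A = 0)"
    using eq_0 by blast
  show "zclos M (UNIV \<times> {0}) = UNIV" "zclos M ({0} \<times> UNIV) = UNIV"
    unfolding zclos_def using fourier_0 by blast+
qed

end
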